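(* Let $D$ be an integral domain and let $\tau_1$ and $\tau_2$ be relations on $D^{\#}$ such that $\tau_1\subseteq\tau_2$ and $\tau_2$ is transitive. Then $\tau_1\circ\tau_2\subseteq\tau_2$ and $\tau_2\circ\tau_1\subseteq\tau_2$. If moreover $id_{Im(\tau_1\circ\tau_2)}\subseteq\tau_1$, then $\tau_1\circ\tau_2$ is transitive; and if moreover $id_{Im(\tau_2\circ\tau_1)}\subseteq\tau_1$, then $\tau_2\circ\tau_1$ is transitive.
   Context: For an integral domain $D$, $D^{\#}$ denotes the set of nonzero nonunit elements of $D$. A relation on $D^{\#}$ is a subset of $D^{\#}\times D^{\#}$ (not necessarily symmetric). Composition is defined by: $a\,(R_1\circ R_2)\,b$ if and only if there exists $c\in D^{\#}$ such that $a\,R_2\,c$ and $c\,R_1\,b$. For a relation $R$ on $D^{\#}$, $Im(R)=\{b\in D^{\#}:\exists a\in D^{\#},\ (a,b)\in R\}$. For $S\subseteq D^{\#}$, $id_S=\{(a,a):a\in S\}$. *)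

theory Defs
  imports Main
begin

definition nonzero_nonunits :: "'a::idom set" where
  "nonzero_nonunits = {x. x \<noteq> 0 \<and> \<not> x dvd 1}"

definition relation_on_nonzero_nonunits :: "'a::idom rel \<Rightarrow> bool" where
  "relation_on_nonzero_nonunits R \<longleftrightarrow> R \<subseteq> nonzero_nonunits \<times> nonzero_nonunits"

(* Composition is read right to left, as for functions: first R2, then R1.
   The library's relcomp (O) reads left to right. *)
abbreviation rel_after :: "'a rel \<Rightarrow> 'a rel \<Rightarrow> 'a rel"  (infixr "\<circ>\<^sub>r" 75) where
  "R1 \<circ>\<^sub>r R2 \<equiv> R2 O R1"

(* For relations on the nonzero nonunits, restricting the intermediate element, or the
   source of the image, to the nonzero nonunits makes no difference. *)
lemma rel_after_iff:
  assumes "relation_on_nonzero_nonunits R1"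
  shows "(a, b) \<in> R1 \<circ>\<^sub>r R2 \<longleftrightarrow> (\<exists>c\<in>nonzero_nonunits. (a, c) \<in> R2 \<and> (c, b) \<in> R1)"
  using assms unfolding relation_on_nonzero_nonunits_def by blast

lemma Range_eq:
  assumes "relation_on_nonzero_nonunits R"
  shows "Range R = {b \<in> nonzero_nonunits. \<exists>a\<in>nonzero_nonunits. (a, b) \<in> R}"
  using assms unfolding relation_on_nonzero_nonunits_def by blast

end

theory Submission
  imports Defs
begin

text \<open>
  Since \<open>\<tau>1 \<subseteq> \<tau>2\<close>, both composites lie in
  \<open>\<tau>2 O \<tau>2\<close>, hence in \<open>\<tau>2\<close>. So a chain of two steps in a composite collapses to a single \<open>\<tau>2\<close>
  step; what has to be recovered is the factor from \<open>\<tau>1\<close>. If \<open>\<tau>1\<close> comes last, reflexivity of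
  \<open>\<tau>1\<close> at the endpoint supplies it; if \<open>\<tau>1\<close> comes first, the initial \<open>\<tau>1\<close> step of the chain is
  still there, and the rest is absorbed into \<open>\<tau>2\<close>.
\<close>

lemma relcomp_subset_trans:
  assumes "r \<subseteq> t" "s \<subseteq> t" "trans t"
  shows "r O s \<subseteq> t"
  using relcomp_mono[OF assms(1,2)] trans_O_subset[OF assms(3)] by (rule subset_trans)

text \<open>
  The collapsed step ends in the range of the composite, so a loop of \<open>r\<close> can be appended to it.
\<close>
lemma trans_relcomp_if_Id_on_Range_subset:
  assumes "r \<subseteq> t" "trans t" "Id_on (Range (t O r)) \<subseteq> r"
  shows "trans (t O r)"
proof (rule transI)
  fix a b c
  assume ab: "(a, b) \<in> t O r" and bc: "(b, c) \<in> t O r"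
  have "t O r \<subseteq> t"
    using assms(1,2) by (intro relcomp_subset_trans) auto
  then have "(a, c) \<in> t"
    using ab bc \<open>trans t\<close> by (blast dest: transD)
  moreover have "(c, c) \<in> r"
    using bc assms(3) by blast
  ultimately show "(a, c) \<in> t O r" by blast
qed

text \<open>
  In \<open>r O t O r O t\<close> everything after the first \<open>r\<close> is absorbed into \<open>t\<close>.
\<close>
lemma trans_relcomp_subset_left:
  assumes "r \<subseteq> t" "trans t"
  shows "trans (r O t)"
proof (rule transI)
  fix a b c
  assume "(a, b) \<in> r O t" and bc: "(b, c) \<in> r O t"
  then obtain x where "(a, x) \<in> r" "(x, b) \<in> t" by blast
  moreover have "(b, c) \<in> t"
    using bc relcomp_subset_trans[OF assms(1) subset_refl assms(2)] by blast
  ultimately show "(a, c) \<in> r O t"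
    using \<open>trans t\<close> by (blast dest: transD)
qed

theorem mainTheorem5:
  fixes \<tau>1 \<tau>2 :: "'a::idom rel"
  assumes "relation_on_nonzero_nonunits \<tau>1"
    and "relation_on_nonzero_nonunits \<tau>2"
    and "\<tau>1 \<subseteq> \<tau>2"
    and "trans \<tau>2"
  shows "\<tau>1 \<circ>\<^sub>r \<tau>2 \<subseteq> \<tau>2 \<and> \<tau>2 \<circ>\<^sub>r \<tau>1 \<subseteq> \<tau>2
    \<and> (Id_on (Range (\<tau>1 \<circ>\<^sub>r \<tau>2)) \<subseteq> \<tau>1 \<longrightarrow> trans (\<tau>1 \<circ>\<^sub>r \<tau>2))
    \<and> (Id_on (Range (\<tau>2 \<circ>\<^sub>r \<tau>1)) \<subseteq> \<tau>1 \<longrightarrow> trans (\<tau>2 \<circ>\<^sub>r \<tau>1))"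
  using relcomp_subset_trans[OF subset_refl assms(3,4)]
    relcomp_subset_trans[OF assms(3) subset_refl assms(4)]
    trans_relcomp_if_Id_on_Range_subset[OF assms(3,4)]
    trans_relcomp_subset_left[OF assms(3,4)]
  by simp

end
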